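(* Fix an integer $b\ge2$ and $\gamma\in(0,1)$, and let $\phi:\mathbb{R}\to\mathbb{R}$ be an analytic $\mathbb{Z}$-periodic function. Then exactly one of the following holds: (i) $\phi$ satisfies condition (H$^*$): $S(x,\mathbf{j})-S(x,\mathbf{i})\equiv0$ (as a function of $x\in[0,1]$) for all $\mathbf{i},\mathbf{j}\in\Sigma$; (ii) $\phi$ satisfies condition (H): $S(x,\mathbf{j})-S(x,\mathbf{i})\not\equiv0$ for all $\mathbf{i}\neq\mathbf{j}\in\Sigma$.
   Context: $\Lambda=\{0,1,\dots,b-1\}$, $\Sigma=\Lambda^{\mathbb{Z}_+}$. For $\mathbf{j}=j_1j_2\cdots\in\Sigma$ and $x\in[0,1]$, $S(x,\mathbf{j})=\sum_{n=1}^{\infty}\gamma^{n-1}\phi\big(\frac{x+j_1+j_2b+\cdots+j_nb^{n-1}}{b^n}\big)$. *)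

theory Defs
  imports "HOL-Analysis.Analysis"
begin

definition real_analytic :: "(real \<Rightarrow> real) \<Rightarrow> bool" where
  "real_analytic f \<longleftrightarrow>
     (\<forall>x. \<exists>r>0. \<exists>c :: nat \<Rightarrow> real. \<forall>y. \<bar>y - x\<bar> < r \<longrightarrow> (\<lambda>n. c n * (y - x) ^ n) sums f y)"

text \<open>Symbolic space: sequences with digits in {0..b-1}; index k (from 0) stands for j_(k+1).\<close>
definition SymSpace :: "nat \<Rightarrow> (nat \<Rightarrow> nat) set" where
  "SymSpace b = {j. \<forall>k. j k < b}"

text \<open>S(x,j) = sum_{n>=1} gamma^(n-1) phi((x + j_1 + j_2 b + ... + j_n b^(n-1)) / b^n),
  written with shifted index n := n+1.\<close>
definition S :: "nat \<Rightarrow> real \<Rightarrow> (real \<Rightarrow> real) \<Rightarrow> real \<Rightarrow> (nat \<Rightarrow> nat) \<Rightarrow> real" where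
  "S b \<gamma> \<phi> x j = (\<Sum>n. \<gamma> ^ n *
      \<phi> ((x + (\<Sum>k<Suc n. real (j k) * real b ^ k)) / real b ^ Suc n))"

definition cond_Hstar :: "nat \<Rightarrow> real \<Rightarrow> (real \<Rightarrow> real) \<Rightarrow> bool" where
  "cond_Hstar b \<gamma> \<phi> \<longleftrightarrow>
     (\<forall>i\<in>SymSpace b. \<forall>j\<in>SymSpace b. \<forall>x\<in>{0..1}. S b \<gamma> \<phi> x j - S b \<gamma> \<phi> x i = 0)"

definition cond_H :: "nat \<Rightarrow> real \<Rightarrow> (real \<Rightarrow> real) \<Rightarrow> bool" where
  "cond_H b \<gamma> \<phi> \<longleftrightarrow>
     (\<forall>i\<in>SymSpace b. \<forall>j\<in>SymSpace b. i \<noteq> j \<longrightarrow>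
        (\<exists>x\<in>{0..1}. S b \<gamma> \<phi> x j - S b \<gamma> \<phi> x i \<noteq> 0))"

end

theory Submission
  imports Defs "HOL-Complex_Analysis.Complex_Analysis"
begin

text \<open>
  Identify a digit sequence with a $b$-adic integer and put $f(x) = S(x, 0)$, so that
  $S(x, \mathbf{j}) = \lim_m f(x + j_1 + \dots + j_m b^{m-1})$ and $f(bx) = \phi(x) + \gamma f(x)$.
  Suppose $S(\cdot, \mathbf{i}) = S(\cdot, \mathbf{j})$ with $\mathbf{i} \neq \mathbf{j}$; by analyticity this
  holds on the whole line. If $d_m$ is the difference of the two $m$-digit truncations and
  $\delta_m = \gcd(d_m, b^m)$, then all multiples of $\delta_m$ are almost periods of $f$ with error
  $O(\gamma^m)$. The functional equation turns them into almost periods $\delta_m / b^k$ of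
  $g(x) = f(x + 1) - f(x)$ with error $O(\gamma^{m-k})$. As the difference of $\mathbf{i}$ and
  $\mathbf{j}$ is a nonzero $b$-adic integer, $\delta_m / b^m \to 0$, so $g$ has arbitrarily fine almost
  periods with arbitrarily small error and is constant. Since $f$ is bounded, $g = 0$; hence $f$ is
  1-periodic and $S(x, \mathbf{j}) = f(x)$ for every $\mathbf{j}$.
\<close>

section \<open>Holomorphic extensions\<close>

text \<open>Real analyticity is recast as a local complex extension, so that the identity theorem
  and locally uniform limits of holomorphic functions apply. Extensions at different centres need
  not be related.\<close>

definition holomorphic_ext :: "(real \<Rightarrow> real) \<Rightarrow> real \<Rightarrow> real \<Rightarrow> (complex \<Rightarrow> complex) \<Rightarrow> bool" where
  "holomorphic_ext h x r H \<longleftrightarrow> H holomorphic_on ball (of_real x) r \<and>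
     (\<forall>y. \<bar>y - x\<bar> < r \<longrightarrow> H (of_real y) = of_real (h y))"

lemma holomorphic_ext_subset:
  assumes "holomorphic_ext h x r H" "ball (complex_of_real y) s \<subseteq> ball (of_real x) r"
  shows "holomorphic_ext h y s H"
proof -
  have "H (of_real z) = of_real (h z)" if "\<bar>z - y\<bar> < s" for z
  proof -
    have "complex_of_real z \<in> ball (of_real y) s"
      using that by (simp add: dist_norm abs_minus_commute flip: of_real_diff)
    then have "complex_of_real z \<in> ball (of_real x) r"
      using assms(2) by blast
    then show ?thesis
      using assms(1) by (simp add: holomorphic_ext_def dist_norm abs_minus_commute flip: of_real_diff)
  qed
  then show ?thesis
    using assms by (auto simp: holomorphic_ext_def intro: holomorphic_on_subset)
qed

lemma holomorphic_ext_isCont: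
  assumes "holomorphic_ext h x r H" "r > 0"
  shows "isCont h x"
proof -
  have "continuous_on (ball (of_real x) r) H"
    using assms holomorphic_on_imp_continuous_on unfolding holomorphic_ext_def by blast
  then have "isCont H (of_real x)"
    using assms(2) by (simp add: continuous_on_eq_continuous_at)
  then have "isCont (\<lambda>y. H (complex_of_real y)) x"
    by (intro isCont_o2[where g = H and f = complex_of_real] continuous_intros)
  then have cont: "isCont (\<lambda>y. Re (H (complex_of_real y))) x"
    by (rule isCont_Re)
  have "\<forall>\<^sub>F y in nhds x. y \<in> ball x r"
    using assms(2) by (intro eventually_nhds_in_open) auto
  then have "\<forall>\<^sub>F y in nhds x. Re (H (complex_of_real y)) = h y"
    by eventually_elim
      (use assms(1) in \<open>auto simp: holomorphic_ext_def dist_real_def abs_minus_commute\<close>)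
  then show ?thesis
    using isCont_cong[of "\<lambda>y. Re (H (complex_of_real y))" h x] cont by simp
qed

text \<open>Identity theorem on the line: the set \<open>Z\<close> of points near which
  \<open>h\<close> vanishes is open, closed and nonempty, hence everything. Closedness is where the
  extensions enter.\<close>

lemma holomorphic_ext_eq_0:
  fixes h :: "real \<Rightarrow> real"
  assumes ext: "\<And>x. \<exists>r>0. \<exists>H. holomorphic_ext h x r H"
    and zero: "\<And>x. x \<in> {u<..<v} \<Longrightarrow> h x = 0" and "u < v"
  shows "h x = 0"
proof -
  define Z where "Z = {x. \<forall>\<^sub>F y in nhds x. h y = 0}"
  have "open Z"
    unfolding Z_def by (subst open_subopen) (auto simp: eventually_nhds)
  moreover have "closed Z"
    unfolding closed_limpt
  proof (intro allI impI)
    fix x assume lim: "x islimpt Z"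
    obtain r H where r: "r > 0" and H: "holomorphic_ext h x r H"
      using ext by blast
    \<comment> \<open>The zeros of \<open>h\<close> near \<open>x\<close>, seen in the complex
      plane, accumulate at the centre of the disc, so \<open>H\<close> vanishes on the whole
      disc.\<close>
    define U where "U = complex_of_real ` (Z \<inter> ball x r)"
    have hZ: "h y = 0" if "y \<in> Z" for y
      using that eventually_nhds_x_imp_x unfolding Z_def by blast
    have Usub: "U \<subseteq> ball (of_real x) r"
      by (auto simp: U_def dist_norm simp flip: of_real_diff)
    have Ulim: "complex_of_real x islimpt U"
      unfolding islimpt_approachable
    proof (intro allI impI)
      fix e :: real assume "e > 0"
      then have "min e r > 0"
        using r by simp
      then obtain y where "y \<in> Z" "y \<noteq> x" "dist y x < min e r"
        using lim unfolding islimpt_approachable by blast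
      then have "complex_of_real y \<in> U" "complex_of_real y \<noteq> of_real x"
        "dist (complex_of_real y) (of_real x) < e"
        by (auto simp: U_def dist_norm abs_minus_commute simp flip: of_real_diff)
      then show "\<exists>x'\<in>U. x' \<noteq> complex_of_real x \<and> dist x' (complex_of_real x) < e"
        by blast
    qed
    have U0: "H z = 0" if z: "z \<in> U" for z
    proof -
      obtain y where "z = of_real y" "y \<in> Z" "\<bar>y - x\<bar> < r"
        using z by (auto simp: U_def dist_real_def abs_minus_commute)
      then show ?thesis
        using H hZ by (simp add: holomorphic_ext_def)
    qed
    have H0: "H w = 0" if "w \<in> ball (of_real x) r" for w
      by (rule analytic_continuation[OF _ open_ball connected_ball Usub _ Ulim U0 that])
        (use H r in \<open>auto simp: holomorphic_ext_def\<close>)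
    have "h y = 0" if "y \<in> ball x r" for y
    proof -
      have "\<bar>y - x\<bar> < r"
        using that by (simp add: dist_real_def abs_minus_commute)
      moreover from this have "complex_of_real y \<in> ball (of_real x) r"
        by (simp add: dist_norm abs_minus_commute flip: of_real_diff)
      ultimately show ?thesis
        using H0 H unfolding holomorphic_ext_def by (metis of_real_eq_0_iff)
    qed
    then show "x \<in> Z"
      unfolding Z_def using r
      by (auto simp: eventually_nhds intro!: exI[of _ "ball x r"])
  qed
  moreover have "(u + v) / 2 \<in> Z"
    unfolding Z_def using zero \<open>u < v\<close>
    by (auto simp: eventually_nhds intro!: exI[of _ "{u<..<v}"])
  ultimately have "Z = UNIV"
    using connected_UNIV[where 'a = real] unfolding connected_clopen by auto
  then show ?thesis
    using eventually_nhds_x_imp_x unfolding Z_def by blast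
qed

section \<open>Complex extensions of \<phi> and of the series\<close>

lemma real_analytic_holomorphic_ext:
  assumes "real_analytic \<phi>"
  shows "\<exists>r>0. \<exists>H. holomorphic_ext \<phi> x r H"
proof -
  obtain r c where r: "r > 0" and c: "\<And>y. \<bar>y - x\<bar> < r \<Longrightarrow> (\<lambda>n. c n * (y - x) ^ n) sums \<phi> y"
    using assms unfolding real_analytic_def by blast
  define H where "H z = (\<Sum>n. complex_of_real (c n) * (z - of_real x) ^ n)" for z
  have sums: "(\<lambda>n. complex_of_real (c n) * (z - of_real x) ^ n) sums H z"
    if z: "z \<in> ball (complex_of_real x) r" for z
  proof -
    \<comment> \<open>Convergence at the real point \<open>x + t\<close>, farther from the centre
      than \<open>z\<close>, forces convergence at the complex point \<open>z\<close>.\<close>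
    obtain t where t: "norm (z - of_real x) < t" "t < r"
      using z dense by (auto simp: dist_norm norm_minus_commute)
    then have "0 \<le> t"
      by (meson less_imp_le norm_ge_zero order_le_less_trans)
    then have "summable (\<lambda>n. c n * t ^ n)"
      using c[of "x + t"] t by (auto simp: sums_iff)
    then have "summable (\<lambda>n. complex_of_real (c n * t ^ n))"
      by (subst summable_of_real_iff)
    then have "summable (\<lambda>n. complex_of_real (c n) * (of_real t) ^ n)"
      by simp
    then have "summable (\<lambda>n. complex_of_real (c n) * (z - of_real x) ^ n)"
      by (rule powser_inside) (use t \<open>0 \<le> t\<close> in auto)
    then show ?thesis
      unfolding H_def by (rule summable_sums)
  qed
  have "H (of_real y) = of_real (\<phi> y)" if y: "\<bar>y - x\<bar> < r" for y
  proof -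
    have "(\<lambda>n. complex_of_real (c n * (y - x) ^ n)) sums of_real (\<phi> y)"
      using c[OF y] by (subst sums_of_real_iff)
    then show ?thesis
      unfolding H_def by (simp add: sums_iff)
  qed
  moreover have "H holomorphic_on ball (of_real x) r"
    using sums by (rule power_series_holomorphic)
  ultimately show ?thesis
    using r unfolding holomorphic_ext_def by blast
qed

lemma periodic_add_of_int:
  fixes \<phi> :: "real \<Rightarrow> 'a"
  assumes "\<And>x. \<phi> (x + 1) = \<phi> x"
  shows "\<phi> (x + of_int k) = \<phi> x"
proof (induction k rule: int_induct[where k = 0])
  case base
  then show ?case by simp
next
  case (step1 i)
  then show ?case
    using assms[of "x + of_int i"] by (simp add: add.assoc)
next
  case (step2 i)
  then show ?case
    using assms[of "x + of_int (i - 1)"] by (simp add: add.assoc)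
qed

text \<open>The terms of \<open>S\<close> evaluate \<phi> at infinitely many points, so one radius
  and one bound must serve all of them. Compactness of the unit interval gives both there, and
  periodicity carries them to the line.\<close>

lemma periodic_real_analytic_uniform_ext:
  assumes an: "real_analytic \<phi>" and per: "\<And>x. \<phi> (x + 1) = \<phi> x"
  obtains r A where "r > 0"
    "\<And>x. \<exists>H. holomorphic_ext \<phi> x r H \<and> (\<forall>z\<in>ball (of_real x) r. norm (H z) \<le> A)"
proof -
  define K where "K = complex_of_real ` {0..1}"
  have "compact K"
    unfolding K_def by (intro compact_continuous_image continuous_intros) auto
  obtain R H where R: "\<And>x. R x > 0" and H: "\<And>x. holomorphic_ext \<phi> x (R x) (H x)"
    using real_analytic_holomorphic_ext[OF an] by metis
  \<comment> \<open>Halving the radius puts the closed disc inside the domain of \<open>H x\<close>,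
    which makes \<open>H x\<close> bounded on \<open>B x\<close>.\<close>
  define B where "B x = ball (complex_of_real x) (R x / 2)" for x
  have bdd: "\<exists>A. \<forall>z\<in>B x. norm (H x z) \<le> A" for x
  proof -
    have "continuous_on (cball (complex_of_real x) (R x / 2)) (H x)"
    proof (rule continuous_on_subset)
      show "continuous_on (ball (of_real x) (R x)) (H x)"
        using H holomorphic_on_imp_continuous_on unfolding holomorphic_ext_def by blast
      show "cball (complex_of_real x) (R x / 2) \<subseteq> ball (of_real x) (R x)"
        using R[of x] by (auto simp: field_simps)
    qed
    then have "bounded (H x ` cball (complex_of_real x) (R x / 2))"
      by (intro compact_imp_bounded compact_continuous_image) auto
    then obtain A where "\<forall>z\<in>cball (complex_of_real x) (R x / 2). norm (H x z) \<le> A"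
      unfolding bounded_iff by blast
    then show ?thesis
      unfolding B_def by (meson ball_subset_cball subsetD)
  qed
  then obtain A where A: "\<And>x z. z \<in> B x \<Longrightarrow> norm (H x z) \<le> A x"
    by metis
  have open_B: "open (B x)" for x
    by (simp add: B_def)
  have cover: "K \<subseteq> (\<Union>x\<in>{0..1}. B x)"
    using R by (auto simp: K_def B_def intro!: bexI)
  obtain X where X: "finite X" "K \<subseteq> (\<Union>x\<in>X. B x)"
    by (rule compactE_image[OF \<open>compact K\<close> open_B cover])
  \<comment> \<open>\<open>r\<close> is a Lebesgue number of the finite cover.\<close>
  obtain r where r: "r > 0" "\<And>z. z \<in> K \<Longrightarrow> \<exists>G\<in>B ` X. ball z r \<subseteq> G"
    by (rule Heine_Borel_lemma[OF \<open>compact K\<close> X(2)]) (use open_B in auto)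
  show thesis
  proof (rule that[OF r(1)])
    fix x :: real
    define y where "y = x + of_int (- \<lfloor>x\<rfloor>)"
    have "of_real y \<in> K"
      unfolding K_def y_def by (intro imageI) (auto, linarith+)
    then obtain t where t: "t \<in> X" "ball (complex_of_real y) r \<subseteq> B t"
      using r(2) by blast
    have "B t \<subseteq> ball (of_real t) (R t)"
      unfolding B_def using R[of t] by (intro subset_ball) simp
    then have ext: "holomorphic_ext \<phi> y r (H t)"
      using H t(2) by (blast intro: holomorphic_ext_subset)
    define G where "G = H t \<circ> (\<lambda>z. z + of_int (- \<lfloor>x\<rfloor>))"
    have mem: "z + of_int (- \<lfloor>x\<rfloor>) \<in> ball (complex_of_real y) r" if "z \<in> ball (of_real x) r" for z
      using that by (simp add: y_def dist_norm)
    have "norm (G z) \<le> (\<Sum>t\<in>X. \<bar>A t\<bar>)" if "z \<in> ball (of_real x) r" for z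
    proof -
      have "norm (G z) \<le> \<bar>A t\<bar>"
        using mem[OF that] t(2) A[of "z + of_int (- \<lfloor>x\<rfloor>)" t] unfolding G_def by fastforce
      also have "\<dots> \<le> (\<Sum>t\<in>X. \<bar>A t\<bar>)"
        using X(1) t(1) by (intro member_le_sum) auto
      finally show ?thesis .
    qed
    moreover have "G holomorphic_on ball (of_real x) r"
      unfolding G_def using ext mem
      by (intro holomorphic_on_compose_gen[where t = "ball (of_real y) r"] holomorphic_intros)
        (auto simp: holomorphic_ext_def)
    moreover have "G (of_real w) = of_real (\<phi> w)" if "\<bar>w - x\<bar> < r" for w
    proof -
      have "\<bar>(w + of_int (- \<lfloor>x\<rfloor>)) - y\<bar> < r"
        using that by (simp add: y_def)
      then have H_eq: "H t (of_real (w + of_int (- \<lfloor>x\<rfloor>))) = of_real (\<phi> (w + of_int (- \<lfloor>x\<rfloor>)))"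
        using ext unfolding holomorphic_ext_def by blast
      have "G (of_real w) = H t (of_real (w + of_int (- \<lfloor>x\<rfloor>)))"
        by (simp add: G_def)
      also have "\<dots> = of_real (\<phi> (w + of_int (- \<lfloor>x\<rfloor>)))"
        by (rule H_eq)
      finally show ?thesis
        by (simp only: periodic_add_of_int[of \<phi>, OF per])
    qed
    ultimately show "\<exists>H. holomorphic_ext \<phi> x r H \<and>
        (\<forall>z\<in>ball (of_real x) r. norm (H z) \<le> (\<Sum>t\<in>X. \<bar>A t\<bar>))"
      unfolding holomorphic_ext_def by blast
  qed
qed

text \<open>The inner maps \<open>q n\<close> divide by a power of \<open>b\<close> and so do not
  expand distances: the radius \<open>r\<close> survives in every term. The M-test with
  \<open>\<gamma> ^ n * A\<close> then gives a uniform, hence holomorphic, limit.\<close>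

lemma S_holomorphic_ext:
  assumes b: "b \<ge> 1" and \<gamma>: "0 < \<gamma>" "\<gamma> < 1"
    and r: "r > 0"
    and ext: "\<And>x. \<exists>H. holomorphic_ext \<phi> x r H \<and> (\<forall>z\<in>ball (of_real x) r. norm (H z) \<le> A)"
  shows "\<exists>H. holomorphic_ext (\<lambda>x. S b \<gamma> \<phi> x j) x r H"
proof -
  define q where "q n z = (z + of_real (\<Sum>k<Suc n. real (j k) * real b ^ k)) / of_real (real b ^ Suc n)"
    for n and z :: complex
  define p where "p n y = (y + (\<Sum>k<Suc n. real (j k) * real b ^ k)) / real b ^ Suc n" for n y
  have qp: "q n (of_real y) = of_real (p n y)" for n y
    by (simp add: q_def p_def)
  have b1: "1 \<le> real b ^ Suc n" for n
    using b by (intro one_le_power) simp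
  have "\<forall>n. \<exists>H. holomorphic_ext \<phi> (p n x) r H \<and> (\<forall>z\<in>ball (of_real (p n x)) r. norm (H z) \<le> A)"
    using ext by blast
  from choice[OF this] obtain H where H: "\<And>n. holomorphic_ext \<phi> (p n x) r (H n)"
    and HA: "\<And>n z. z \<in> ball (of_real (p n x)) r \<Longrightarrow> norm (H n z) \<le> A"
    by blast
  have mem: "q n z \<in> ball (of_real (p n x)) r" if "z \<in> ball (of_real x) r" for n z
  proof -
    have "q n z - of_real (p n x) = (z - of_real x) / of_real (real b ^ Suc n)"
      unfolding qp[symmetric] q_def by (simp add: diff_divide_distrib[symmetric])
    then have "norm (q n z - of_real (p n x)) = norm (z - of_real x) / (real b ^ Suc n)"
      using b by (simp add: norm_divide norm_mult norm_power)
    also have "\<dots> \<le> norm (z - of_real x) / 1"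
      using b1[of n] by (intro divide_left_mono) auto
    finally show ?thesis
      using that by (simp add: dist_norm norm_minus_commute)
  qed
  define T where "T n z = of_real (\<gamma> ^ n) * H n (q n z)" for n z
  have T_le: "norm (T n z) \<le> \<gamma> ^ n * A" if "z \<in> ball (of_real x) r" for n z
    using HA[OF mem[OF that]] \<gamma> by (simp add: T_def norm_mult norm_power mult_left_mono)
  have sumA: "summable (\<lambda>n. \<gamma> ^ n * A)"
    using \<gamma> by (intro summable_mult2 summable_geometric) auto
  have lim: "uniform_limit (ball (of_real x) r) (\<lambda>n z. \<Sum>i<n. T i z) (\<lambda>z. \<Sum>i. T i z) sequentially"
    using T_le sumA by (rule Weierstrass_m_test)
  have Thol: "T n holomorphic_on ball (of_real x) r" for n
  proof -
    have "q n holomorphic_on ball (of_real x) r"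
      using b unfolding q_def by (intro holomorphic_intros) auto
    then have "(H n \<circ> q n) holomorphic_on ball (of_real x) r"
      using H[of n] mem
      by (intro holomorphic_on_compose_gen[where t = "ball (of_real (p n x)) r"])
        (auto simp: holomorphic_ext_def)
    then show ?thesis
      unfolding T_def by (intro holomorphic_intros) (simp add: o_def)
  qed
  have "(\<lambda>z. \<Sum>i. T i z) holomorphic_on ball (of_real x) r"
  proof (rule holomorphic_uniform_sequence[OF open_ball])
    show "(\<lambda>z. \<Sum>i<n. T i z) holomorphic_on ball (of_real x) r" for n
      by (intro holomorphic_intros Thol)
    fix z assume "z \<in> ball (complex_of_real x) r"
    then obtain d where "d > 0" "cball z d \<subseteq> ball (complex_of_real x) r"
      using open_contains_cball[of "ball (complex_of_real x) r"] by (meson open_ball)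
    then show "\<exists>d>0. cball z d \<subseteq> ball (complex_of_real x) r \<and>
        uniform_limit (cball z d) (\<lambda>n z. \<Sum>i<n. T i z) (\<lambda>z. \<Sum>i. T i z) sequentially"
      using uniform_limit_on_subset[OF lim] by blast
  qed
  moreover have "(\<Sum>i. T i (of_real y)) = of_real (S b \<gamma> \<phi> y j)" if y: "\<bar>y - x\<bar> < r" for y
  proof -
    have yb: "complex_of_real y \<in> ball (of_real x) r"
      using y by (simp add: dist_norm abs_minus_commute flip: of_real_diff)
    have T_eq: "T n (of_real y) = of_real (\<gamma> ^ n * \<phi> (p n y))" for n
    proof -
      have "complex_of_real (p n y) \<in> ball (of_real (p n x)) r"
        using mem[OF yb, of n] by (simp add: qp)
      then have "\<bar>p n y - p n x\<bar> < r"
        by (simp add: dist_norm abs_minus_commute flip: of_real_diff)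
      then show ?thesis
        using H[of n] by (simp add: T_def qp holomorphic_ext_def)
    qed
    have "summable (\<lambda>n. T n (of_real y))"
      using T_le[OF yb] sumA by (intro summable_comparison_test[OF _ sumA]) auto
    then have "summable (\<lambda>n. \<gamma> ^ n * \<phi> (p n y))"
      unfolding T_eq by (subst (asm) summable_of_real_iff)
    then have "(\<Sum>n. complex_of_real (\<gamma> ^ n * \<phi> (p n y))) = of_real (\<Sum>n. \<gamma> ^ n * \<phi> (p n y))"
      by (rule suminf_of_real[symmetric])
    then show ?thesis
      unfolding T_eq S_def p_def .
  qed
  ultimately show ?thesis
    unfolding holomorphic_ext_def by blast
qed

section \<open>Fine almost periods\<close>

text \<open>Some multiple of \<open>h\<close> carries \<open>x\<close> to within \<eta> of
  \<open>y\<close>. The error is uniform in \<open>j\<close>, so the number of steps does not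
  matter, and continuity at \<open>y\<close> does the rest.\<close>

lemma constant_if_fine_almost_periods:
  fixes g :: "real \<Rightarrow> real"
  assumes cont: "\<And>x. isCont g x"
    and per: "\<And>\<epsilon> \<eta>. \<epsilon> > 0 \<Longrightarrow> \<eta> > 0 \<Longrightarrow>
      \<exists>h. 0 < h \<and> h < \<eta> \<and> (\<forall>x. \<forall>j::int. \<bar>g (x + of_int j * h) - g x\<bar> \<le> \<epsilon>)"
  shows "g x = g y"
proof -
  have "\<bar>g x - g y\<bar> \<le> e" if e: "e > 0" for e
  proof -
    obtain \<eta> where \<eta>: "\<eta> > 0" "\<And>z. \<bar>z - y\<bar> < \<eta> \<Longrightarrow> \<bar>g z - g y\<bar> < e / 2"
      using cont[of y] half_gt_zero[OF e] unfolding continuous_at_eps_delta dist_real_def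
      by blast
    obtain h where h: "0 < h" "h < \<eta>" "\<And>x j. \<bar>g (x + of_int j * h) - g x\<bar> \<le> e / 2"
      using per[of "e / 2" \<eta>] \<open>e > 0\<close> \<eta>(1) by auto
    define j where "j = \<lfloor>(y - x) / h\<rfloor>"
    have "of_int j \<le> (y - x) / h" "(y - x) / h < of_int j + 1"
      unfolding j_def by linarith+
    then have "of_int j * h \<le> y - x" "y - x < of_int j * h + h"
      using h(1) by (auto simp: field_simps)
    then have "\<bar>(x + of_int j * h) - y\<bar> < \<eta>"
      using h(2) by linarith
    from \<eta>(2)[OF this] h(3)[of x j] show ?thesis
      by linarith
  qed
  then show ?thesis
    using field_le_epsilon[of "\<bar>g x - g y\<bar>" 0] by simp
qed

section \<open>Divisibility of residues of a nonzero b-adic integer\<close>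

text \<open>The sequence \<open>d\<close> stands for the residues of a \<open>b\<close>-adic integer that is nonzero modulo
  \<open>b ^ r\<close>.\<close>

lemma gcd_residue_bound:
  fixes b :: int and d :: "nat \<Rightarrow> int"
  assumes b: "b \<ge> 2" and nd: "\<not> b ^ r dvd d r"
    and cong: "\<And>m. m \<ge> r \<Longrightarrow> b ^ r dvd d m - d r"
  shows "\<exists>a. \<forall>m\<ge>a. gcd (d m) (b ^ m) * 2 ^ (m - a) \<le> b ^ m"
proof -
  \<comment> \<open>As \<open>b ^ r\<close> does not divide \<open>d r\<close>, some prime occurs in
    \<open>d r\<close> to a lower power than in \<open>b ^ r\<close>.\<close>
  obtain p where p: "prime p" "\<not> multiplicity p (b ^ r) \<le> multiplicity p (d r)"
    using nd multiplicity_le_imp_dvd[of "b ^ r" "d r"] b by auto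
  define a where "a = multiplicity p (b ^ r)"
  have pa: "p ^ a dvd b ^ r"
    unfolding a_def by (rule multiplicity_dvd)
  have "d r \<noteq> 0"
    using nd by auto
  then have npa: "\<not> p ^ a dvd d r"
    using p power_dvd_iff_le_multiplicity[of "d r" p a]
    by (simp add: a_def prime_int_iff)
  have "a > 0"
    using p a_def by simp
  then have "p dvd b ^ r"
    using pa by (meson dvd_power dvd_trans)
  then have pb: "p dvd b"
    using p(1) prime_dvd_power by blast
  have p2: "p \<ge> 2"
    using p(1) prime_ge_2_int by blast
  show ?thesis
  proof (intro exI allI impI)
    \<comment> \<open>The witness is \<open>max a r\<close>: \<open>m \<ge> r\<close> makes the
      congruence available, and \<open>m \<ge> a\<close> keeps \<open>Suc m - a\<close> from
      truncating.\<close>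
    fix m assume m: "m \<ge> max a r"
    define \<delta> where "\<delta> = gcd (d m) (b ^ m)"
    have bm: "b ^ m > 0"
      using b by simp
    have "\<delta> > 0"
      unfolding \<delta>_def using bm by (metis gcd_pos_int less_irrefl)
    obtain q where q: "b ^ m = \<delta> * q"
      unfolding \<delta>_def by (meson dvdE gcd_dvd2)
    obtain t where t: "d m = \<delta> * t"
      unfolding \<delta>_def by (meson dvdE gcd_dvd1)
    have "q > 0"
      using bm \<open>\<delta> > 0\<close> unfolding q by (simp add: zero_less_mult_iff)
    have "\<not> p ^ a dvd d m"
    proof
      assume "p ^ a dvd d m"
      moreover have "p ^ a dvd d m - d r"
        using cong[of m] m pa dvd_trans by auto
      ultimately show False
        using npa by (metis dvd_diff_right_iff dvd_diff_commute)
    qed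
    moreover have "p ^ m dvd d m * q"
    proof -
      have "d m * q = b ^ m * t"
        unfolding q t by simp
      then show ?thesis
        using pb by (simp add: dvd_power_same dvd_mult2)
    qed
    \<comment> \<open>Of the \<open>m\<close> factors \<open>p\<close> in \<open>d m * q\<close>,
      fewer than \<open>a\<close> can lie in \<open>d m\<close>; the rest divide the cofactor
      \<open>q\<close> of the gcd.\<close>
    ultimately have "p ^ (Suc m - a) dvd q"
      using prime_elem_power_dvd_cases[of p m "d m" q a "Suc m - a"] m p(1) by auto
    then have "p ^ (m - a) dvd q"
      by (meson diff_le_mono le_imp_power_dvd dvd_trans le_Suc_eq order_refl)
    then have "p ^ (m - a) \<le> q"
      using \<open>q > 0\<close> by (rule zdvd_imp_le)
    moreover have "2 ^ (m - a) \<le> p ^ (m - a)"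
      using p2 by (intro power_mono) auto
    moreover have "(2::int) ^ (m - max a r) \<le> 2 ^ (m - a)"
      by (intro power_increasing) auto
    ultimately have "2 ^ (m - max a r) \<le> q"
      by linarith
    then have "\<delta> * 2 ^ (m - max a r) \<le> b ^ m"
      using \<open>\<delta> > 0\<close> unfolding q by simp
    then show "gcd (d m) (b ^ m) * 2 ^ (m - max a r) \<le> b ^ m"
      unfolding \<delta>_def .
  qed
qed

section \<open>The series \<open>S\<close>\<close>

text \<open>The residue modulo \<open>b ^ m\<close> of the b-adic integer with digits
  \<open>j\<close>; integer-valued so that differences can be taken.\<close>

definition trunc_digits :: "nat \<Rightarrow> (nat \<Rightarrow> nat) \<Rightarrow> nat \<Rightarrow> int" where
  "trunc_digits b j m = (\<Sum>k<m. int (j k) * int b ^ k)"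

lemma trunc_digits_zero [simp]: "trunc_digits b (\<lambda>_. 0) m = 0"
  by (simp add: trunc_digits_def)

lemma trunc_digits_cong:
  assumes "r \<le> m"
  shows "int b ^ r dvd trunc_digits b j m - trunc_digits b j r"
proof -
  have "trunc_digits b j m - trunc_digits b j r = (\<Sum>k=r..<m. int (j k) * int b ^ k)"
    unfolding trunc_digits_def using assms sum_diff_nat_ivl[of 0 r m "\<lambda>k. int (j k) * int b ^ k"]
    by (simp add: lessThan_atLeast0)
  also have "int b ^ r dvd \<dots>"
    by (intro dvd_sum dvd_mult le_imp_power_dvd) auto
  finally show ?thesis .
qed

text \<open>At the first differing digit, with index \<open>r\<close>, the truncations to
  \<open>Suc r\<close> digits differ by a nonzero digit difference, smaller than \<open>b\<close> in
  absolute value, times \<open>b ^ r\<close>.\<close>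

lemma trunc_digits_neq:
  assumes "i \<in> SymSpace b" "j \<in> SymSpace b" "i \<noteq> j"
  obtains r where "\<not> int b ^ r dvd trunc_digits b j r - trunc_digits b i r"
proof -
  define r where "r = (LEAST k. i k \<noteq> j k)"
  have "\<exists>k. i k \<noteq> j k"
    using assms(3) by auto
  then have r: "i r \<noteq> j r"
    unfolding r_def by (rule LeastI_ex)
  have less: "i k = j k" if "k < r" for k
    using not_less_Least that unfolding r_def by blast
  have lt: "i r < b" "j r < b"
    using assms by (auto simp: SymSpace_def)
  have "trunc_digits b j (Suc r) - trunc_digits b i (Suc r) = (int (j r) - int (i r)) * int b ^ r"
    using less by (simp add: trunc_digits_def algebra_simps)
  moreover have "\<not> int b ^ Suc r dvd (int (j r) - int (i r)) * int b ^ r"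
  proof
    assume "int b ^ Suc r dvd (int (j r) - int (i r)) * int b ^ r"
    then have "int b dvd int (j r) - int (i r)"
      using lt by (simp add: mult.commute)
    then have "int b \<le> \<bar>int (j r) - int (i r)\<bar>"
      using r by (intro zdvd_imp_le) auto
    then show False
      using lt by linarith
  qed
  ultimately show thesis
    using that by metis
qed

section \<open>Congruent arguments and the functional equation\<close>

text \<open>Analyticity is left out on purpose: the argument below sees it only through continuity
  of \<open>f\<close> and equality of two series on the whole line.\<close>

locale bounded_periodic =
  fixes b :: nat and \<gamma> :: real and \<phi> :: "real \<Rightarrow> real" and M :: real
  assumes b2: "b \<ge> 2" and \<gamma>_pos: "0 < \<gamma>" and \<gamma>_less: "\<gamma> < 1"
    and per: "\<And>x. \<phi> (x + 1) = \<phi> x"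
    and bound: "\<And>x. \<bar>\<phi> x\<bar> \<le> M"
begin

text \<open>\<open>C * \<gamma> ^ m\<close> bounds the difference of two tails of the series from
  index \<open>m\<close> on.\<close>

definition C :: real where "C = 2 * M / (1 - \<gamma>)"

definition f :: "real \<Rightarrow> real" where "f x = S b \<gamma> \<phi> x (\<lambda>_. 0)"

lemma S_trunc_digits:
  "S b \<gamma> \<phi> x j = (\<Sum>n. \<gamma> ^ n * \<phi> ((x + of_int (trunc_digits b j (Suc n))) / real b ^ Suc n))"
  by (simp only: S_def trunc_digits_def of_int_sum of_int_mult of_int_power of_int_of_nat_eq)

lemma summable_bounded: "summable (\<lambda>n. \<gamma> ^ n * \<phi> (u n))"
proof (rule summable_comparison_test)
  show "\<exists>N. \<forall>n\<ge>N. norm (\<gamma> ^ n * \<phi> (u n)) \<le> \<gamma> ^ n * M"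
    using bound \<gamma>_pos by (auto simp: abs_mult intro!: mult_left_mono)
  show "summable (\<lambda>n. \<gamma> ^ n * M)"
    using \<gamma>_pos \<gamma>_less by (intro summable_mult2 summable_geometric) auto
qed

text \<open>Congruence modulo \<open>b ^ m\<close> makes the arguments in the first \<open>m\<close>
  terms differ by integers, so these terms agree by periodicity and only the tails remain.\<close>

lemma S_close:
  assumes eq: "x + of_int (trunc_digits b i m) = y + of_int (trunc_digits b j m) + real b ^ m * of_int l"
  shows "\<bar>S b \<gamma> \<phi> x i - S b \<gamma> \<phi> y j\<bar> \<le> C * \<gamma> ^ m"
proof -
  define s where "s n = \<phi> ((x + of_int (trunc_digits b i (Suc n))) / real b ^ Suc n)" for n
  define t where "t n = \<phi> ((y + of_int (trunc_digits b j (Suc n))) / real b ^ Suc n)" for n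
  have st: "s n = t n" if "n < m" for n
  proof -
    have "Suc n \<le> m"
      using that by simp
    obtain u where u: "trunc_digits b i m - trunc_digits b i (Suc n) = int b ^ Suc n * u"
      using trunc_digits_cong[OF \<open>Suc n \<le> m\<close>, of b i] by (elim dvdE)
    obtain v where v: "trunc_digits b j m - trunc_digits b j (Suc n) = int b ^ Suc n * v"
      using trunc_digits_cong[OF \<open>Suc n \<le> m\<close>, of b j] by (elim dvdE)
    obtain w where w: "int b ^ m = int b ^ Suc n * w"
      using le_imp_power_dvd[OF \<open>Suc n \<le> m\<close>, of "int b"] by (elim dvdE)
    have u': "real_of_int (trunc_digits b i m) = of_int (trunc_digits b i (Suc n)) + real b ^ Suc n * of_int u"
      using arg_cong[OF u, of real_of_int] by simp
    have v': "real_of_int (trunc_digits b j m) = of_int (trunc_digits b j (Suc n)) + real b ^ Suc n * of_int v"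
      using arg_cong[OF v, of real_of_int] by simp
    have w': "real b ^ m = real b ^ Suc n * of_int w"
      using arg_cong[OF w, of real_of_int] by simp
    \<comment> \<open>The congruence modulo \<open>b ^ m\<close> is lowered to
      \<open>b ^ Suc n\<close>, the denominator of term \<open>n\<close>; digits from position
      \<open>Suc n\<close> on only change the quotient.\<close>
    have "x + of_int (trunc_digits b i (Suc n)) =
        y + of_int (trunc_digits b j (Suc n)) + real b ^ Suc n * of_int (v + w * l - u)"
      using eq unfolding u' v' w' by (simp add: algebra_simps)
    moreover have "real b ^ Suc n \<noteq> 0"
      using b2 by simp
    ultimately have "(x + of_int (trunc_digits b i (Suc n))) / real b ^ Suc n =
        (y + of_int (trunc_digits b j (Suc n))) / real b ^ Suc n + of_int (v + w * l - u)"
      by (simp only: add_divide_distrib[of _ "_ * _"] nonzero_mult_div_cancel_left[of "real b ^ Suc n"] not_False_eq_True)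
    then show ?thesis
      unfolding s_def t_def by (simp only: periodic_add_of_int[of \<phi>, OF per])
  qed
  define e where "e n = \<gamma> ^ n * s n - \<gamma> ^ n * t n" for n
  have sum_e: "summable e"
    unfolding e_def s_def t_def by (intro summable_diff summable_bounded)
  have "S b \<gamma> \<phi> x i - S b \<gamma> \<phi> y j = suminf e"
    unfolding S_trunc_digits e_def s_def t_def by (intro suminf_diff summable_bounded)
  also have "\<dots> = (\<Sum>n. e (n + m))"
  proof -
    have "sum e {..<m} = 0"
      using st by (simp add: e_def)
    then show ?thesis
      by (simp add: suminf_minus_initial_segment[OF sum_e])
  qed
  finally have eq_tail: "S b \<gamma> \<phi> x i - S b \<gamma> \<phi> y j = (\<Sum>n. e (n + m))" .
  have e_le: "norm (e (n + m)) \<le> 2 * M * \<gamma> ^ m * \<gamma> ^ n" for n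
  proof -
    have "\<bar>s (n + m)\<bar> \<le> M" "\<bar>t (n + m)\<bar> \<le> M"
      unfolding s_def t_def by (rule bound)+
    then have "\<bar>s (n + m) - t (n + m)\<bar> \<le> 2 * M"
      by linarith
    then have "\<gamma> ^ (n + m) * \<bar>s (n + m) - t (n + m)\<bar> \<le> \<gamma> ^ (n + m) * (2 * M)"
      using \<gamma>_pos by (intro mult_left_mono) auto
    moreover have "norm (e (n + m)) = \<gamma> ^ (n + m) * \<bar>s (n + m) - t (n + m)\<bar>"
      using \<gamma>_pos by (simp add: e_def abs_mult flip: right_diff_distrib)
    ultimately show ?thesis
      by (simp add: power_add mult_ac)
  qed
  have geo: "summable (\<lambda>n. 2 * M * \<gamma> ^ m * \<gamma> ^ n)"
    using \<gamma>_pos \<gamma>_less by (intro summable_mult summable_geometric) auto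
  have "norm (\<Sum>n. e (n + m)) \<le> (\<Sum>n. 2 * M * \<gamma> ^ m * \<gamma> ^ n)"
    using geo e_le by (intro norm_suminf_le) auto
  also have "\<dots> = C * \<gamma> ^ m"
    using \<gamma>_pos \<gamma>_less by (subst suminf_mult) (auto simp: suminf_geometric C_def)
  finally show ?thesis
    unfolding eq_tail by simp
qed

lemma S_close_f: "\<bar>S b \<gamma> \<phi> x i - f (x + of_int (trunc_digits b i m))\<bar> \<le> C * \<gamma> ^ m"
  unfolding f_def by (rule S_close[where l = 0]) simp

lemma f_almost_period: "\<bar>f (x + real b ^ m * of_int l) - f x\<bar> \<le> C * \<gamma> ^ m"
  unfolding f_def by (rule S_close[where l = l]) simp

lemma f_mult_b: "f (real b * x) = \<phi> x + \<gamma> * f x"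
proof -
  have f_eq: "f y = (\<Sum>n. \<gamma> ^ n * \<phi> (y / real b ^ Suc n))" for y
    by (simp only: f_def S_trunc_digits trunc_digits_zero of_int_0 add_0_right)
  have "f (real b * x) = (\<Sum>n. \<gamma> ^ n * \<phi> (x / real b ^ n))"
    unfolding f_eq using b2 by simp
  also have "\<dots> = \<phi> x + (\<Sum>n. \<gamma> ^ Suc n * \<phi> (x / real b ^ Suc n))"
    by (subst suminf_split_head[OF summable_bounded]) simp
  also have "(\<Sum>n. \<gamma> ^ Suc n * \<phi> (x / real b ^ Suc n)) = \<gamma> * f x"
    unfolding f_eq by (subst suminf_mult[OF summable_bounded, symmetric]) (simp add: mult.assoc)
  finally show ?thesis .
qed

text \<open>In each step \<phi> cancels, since its two arguments differ by the integer
  \<open>b ^ k\<close>, and the functional equation leaves a factor \<gamma>.\<close>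

lemma f_scaled_diff:
  "f (real b ^ k * (x + 1)) - f (real b ^ k * x) = \<gamma> ^ k * (f (x + 1) - f x)"
proof (induction k)
  case 0
  then show ?case by simp
next
  case (Suc k)
  have "real b ^ k * (x + 1) = real b ^ k * x + of_int (int b ^ k)"
    by (simp add: algebra_simps)
  then have "\<phi> (real b ^ k * (x + 1)) = \<phi> (real b ^ k * x)"
    by (simp only: periodic_add_of_int[of \<phi>, OF per])
  then have "f (real b * (real b ^ k * (x + 1))) - f (real b * (real b ^ k * x)) =
      \<gamma> * (f (real b ^ k * (x + 1)) - f (real b ^ k * x))"
    unfolding f_mult_b by (simp add: algebra_simps)
  then show ?case
    unfolding Suc.IH by (simp add: mult.assoc)
qed

lemma f_bounded: "\<bar>f x\<bar> \<le> M / (1 - \<gamma>)"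
proof -
  have "summable (\<lambda>n. M * \<gamma> ^ n)"
    using \<gamma>_pos \<gamma>_less by (intro summable_mult summable_geometric) auto
  then have "norm (f x) \<le> (\<Sum>n. M * \<gamma> ^ n)"
    unfolding f_def S_trunc_digits using bound \<gamma>_pos
    by (intro norm_suminf_le) (auto simp: abs_mult mult.commute[of M] intro!: mult_left_mono)
  also have "\<dots> = M / (1 - \<gamma>)"
    using \<gamma>_pos \<gamma>_less by (subst suminf_mult) (auto simp: suminf_geometric)
  finally show ?thesis
    by simp
qed

lemma tendsto_const_mult_power: "(\<lambda>m. a * \<gamma> ^ m) \<longlonglongrightarrow> 0"
  using \<gamma>_pos \<gamma>_less by (intro tendsto_mult_right_zero LIMSEQ_power_zero) auto

section \<open>Consequences of two sequences with the same series\<close>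

context
  fixes i j :: "nat \<Rightarrow> nat"
  assumes S_eq: "\<And>x. S b \<gamma> \<phi> x i = S b \<gamma> \<phi> x j"
begin

definition d :: "nat \<Rightarrow> int" where "d m = trunc_digits b j m - trunc_digits b i m"

lemma d_cong: "r \<le> m \<Longrightarrow> int b ^ r dvd d m - d r"
  using dvd_diff[OF trunc_digits_cong[of r m b j] trunc_digits_cong[of r m b i]]
  by (simp add: d_def algebra_simps)

text \<open>One shift by \<open>d m\<close> is compared through the common value of the two series
  at \<open>z\<close>; iterating adds up the errors, whence the factor \<open>k\<close>.\<close>

lemma f_shift_d_nat_weak: "\<bar>f (x + real k * of_int (d m)) - f x\<bar> \<le> real k * (2 * C * \<gamma> ^ m)"
proof (induction k)
  case 0
  then show ?case by simp
next
  case (Suc k)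
  define y where "y = x + real k * of_int (d m)"
  \<comment> \<open>Adding the two truncations to \<open>z\<close> gives \<open>y\<close> and
    \<open>y + d m\<close> respectively.\<close>
  define z where "z = y - of_int (trunc_digits b i m)"
  have "\<bar>S b \<gamma> \<phi> z i - f y\<bar> \<le> C * \<gamma> ^ m"
    using S_close_f[of z i m] by (simp add: z_def)
  moreover have "\<bar>S b \<gamma> \<phi> z i - f (y + of_int (d m))\<bar> \<le> C * \<gamma> ^ m"
    using S_close_f[of z j m] by (simp add: z_def d_def S_eq algebra_simps)
  ultimately have "\<bar>f (y + of_int (d m)) - f y\<bar> \<le> 2 * C * \<gamma> ^ m"
    by linarith
  moreover have "x + real (Suc k) * of_int (d m) = y + of_int (d m)"
    by (simp add: y_def algebra_simps)
  moreover have "real (Suc k) * (2 * C * \<gamma> ^ m) = real k * (2 * C * \<gamma> ^ m) + 2 * C * \<gamma> ^ m"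
    by (simp add: algebra_simps)
  ultimately show ?case
    using Suc.IH unfolding y_def[symmetric] by (smt (verit))
qed

text \<open>The accumulated error is removed by passing to \<open>d m'\<close> with \<open>m' \<rightarrow> \<infinity>\<close>.\<close>

lemma f_shift_d_nat: "\<bar>f (x + real k * of_int (d m)) - f x\<bar> \<le> C * \<gamma> ^ m"
proof -
  have "\<bar>f (x + real k * of_int (d m)) - f x\<bar> \<le> C * \<gamma> ^ m + (real k * (2 * C)) * \<gamma> ^ m'" if m': "m' \<ge> m" for m'
  proof -
    \<comment> \<open>Since \<open>d m'\<close> and \<open>d m\<close> agree modulo
      \<open>b ^ m\<close>, exchanging them costs \<open>C * \<gamma> ^ m\<close> for every
      \<open>k\<close>.\<close>
    obtain l where l: "d m' - d m = int b ^ m * l"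
      using d_cong[OF m'] by (elim dvdE)
    have "real_of_int (d m') = of_int (d m) + real b ^ m * of_int l"
      using arg_cong[OF l, of real_of_int] by simp
    then have "x + real k * of_int (d m') = x + real k * of_int (d m) + real b ^ m * of_int (int k * l)"
      by (simp add: algebra_simps)
    then have "\<bar>f (x + real k * of_int (d m')) - f (x + real k * of_int (d m))\<bar> \<le> C * \<gamma> ^ m"
      by (simp only: f_almost_period)
    moreover have "\<bar>f (x + real k * of_int (d m')) - f x\<bar> \<le> (real k * (2 * C)) * \<gamma> ^ m'"
      using f_shift_d_nat_weak[of x k m'] by (simp add: mult.assoc)
    ultimately show ?thesis
      by linarith
  qed
  moreover have "(\<lambda>m'. C * \<gamma> ^ m + (real k * (2 * C)) * \<gamma> ^ m') \<longlonglongrightarrow> C * \<gamma> ^ m + 0"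
    by (intro tendsto_add tendsto_const tendsto_const_mult_power)
  ultimately show ?thesis
    by (intro LIMSEQ_le_const) auto
qed

lemma f_shift_d: "\<bar>f (x + of_int n * of_int (d m)) - f x\<bar> \<le> C * \<gamma> ^ m"
proof (cases n rule: int_cases2)
  case (nonneg k)
  then show ?thesis
    using f_shift_d_nat by simp
next
  case (nonpos k)
  then show ?thesis
    using f_shift_d_nat[of "x + of_int n * of_int (d m)" k m] by (simp add: abs_minus_commute)
qed

text \<open>By Bezout a multiple of the gcd is a multiple of \<open>d m\<close> plus one of
  \<open>b ^ m\<close>, each an almost period with error \<open>C * \<gamma> ^ m\<close>.\<close>

lemma f_shift_gcd:
  "\<bar>f (x + of_int l * of_int (gcd (d m) (int b ^ m))) - f x\<bar> \<le> 2 * C * \<gamma> ^ m"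
proof -
  obtain u v where uv: "u * d m + v * int b ^ m = gcd (d m) (int b ^ m)"
    using bezout_int by blast
  have "real_of_int (gcd (d m) (int b ^ m)) = of_int u * of_int (d m) + of_int v * real b ^ m"
    unfolding uv[symmetric] by simp
  then have "x + of_int l * of_int (gcd (d m) (int b ^ m)) =
      (x + of_int (l * u) * of_int (d m)) + real b ^ m * of_int (l * v)"
    by (simp add: algebra_simps)
  then have "\<bar>f (x + of_int l * of_int (gcd (d m) (int b ^ m))) - f (x + of_int (l * u) * of_int (d m))\<bar>
      \<le> C * \<gamma> ^ m"
    by (simp only: f_almost_period)
  with f_shift_d[of x "l * u" m] show ?thesis
    by linarith
qed

definition g :: "real \<Rightarrow> real" where "g x = f (x + 1) - f x"

text \<open>Scaling by \<open>b ^ k\<close> turns the step into a multiple of the gcd, which moves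
  \<open>f\<close> little at both ends of the increment. Dividing by \<open>\<gamma> ^ k\<close>
  leaves \<open>\<gamma> ^ s\<close> of the error.\<close>

lemma g_almost_period:
  "\<bar>g (x + of_int l * (of_int (gcd (d (k + s)) (int b ^ (k + s))) / real b ^ k)) - g x\<bar> \<le> 4 * C * \<gamma> ^ s"
proof -
  define \<delta> where "\<delta> = real_of_int (gcd (d (k + s)) (int b ^ (k + s)))"
  define y where "y = x + of_int l * (\<delta> / real b ^ k)"
  have bk: "real b ^ k \<noteq> 0"
    using b2 by simp
  have y0: "real b ^ k * y = real b ^ k * x + of_int l * \<delta>"
    using bk by (simp add: y_def distrib_left)
  then have y1: "real b ^ k * (y + 1) = real b ^ k * (x + 1) + of_int l * \<delta>"
    by (simp add: distrib_left)
  have "\<gamma> ^ k * (g y - g x) = (f (real b ^ k * (y + 1)) - f (real b ^ k * (x + 1)))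
      - (f (real b ^ k * y) - f (real b ^ k * x))"
    using f_scaled_diff[of k x] f_scaled_diff[of k y] by (simp add: g_def algebra_simps)
  moreover have "\<bar>f (real b ^ k * (y + 1)) - f (real b ^ k * (x + 1))\<bar> \<le> 2 * C * \<gamma> ^ (k + s)"
    unfolding y1 \<delta>_def by (rule f_shift_gcd)
  moreover have "\<bar>f (real b ^ k * y) - f (real b ^ k * x)\<bar> \<le> 2 * C * \<gamma> ^ (k + s)"
    unfolding y0 \<delta>_def by (rule f_shift_gcd)
  ultimately have "\<bar>\<gamma> ^ k * (g y - g x)\<bar> \<le> 4 * C * \<gamma> ^ (k + s)"
    by linarith
  then have "\<gamma> ^ k * \<bar>g y - g x\<bar> \<le> \<gamma> ^ k * (4 * C * \<gamma> ^ s)"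
    using \<gamma>_pos by (simp add: abs_mult power_add mult_ac)
  then show ?thesis
    using \<gamma>_pos unfolding y_def \<delta>_def by simp
qed

lemma S_eq_f:
  assumes neq: "\<not> int b ^ r dvd d r" and cont: "\<And>x. isCont f x"
  shows "S b \<gamma> \<phi> x q = f x"
proof -
  have b2': "int b \<ge> 2"
    using b2 by simp
  obtain a where a: "\<And>m. m \<ge> a \<Longrightarrow> gcd (d m) (int b ^ m) * 2 ^ (m - a) \<le> int b ^ m"
    using gcd_residue_bound[of "int b" r d, OF b2' neq d_cong] by blast
  have g_const: "g x = g y" for x y
  proof (rule constant_if_fine_almost_periods[where g = g])
    show "isCont g x" for x
      unfolding g_def by (intro continuous_intros isCont_o2[where g = f and f = "\<lambda>x. x + 1"] cont)
    fix \<epsilon> \<eta> :: real assume \<epsilon>: "\<epsilon> > 0" and \<eta>: "\<eta> > 0"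
    have "\<forall>\<^sub>F s in sequentially. 4 * C * \<gamma> ^ s < \<epsilon>"
      using tendsto_const_mult_power \<epsilon> by (rule order_tendstoD(2))
    \<comment> \<open>The error depends on \<open>s\<close> alone, so \<open>s\<close> is fixed
      first; the step is then made small through \<open>n\<close>, with \<open>n \<ge> s\<close> so
      that \<open>m - s\<close> does not truncate.\<close>
    then obtain s where s: "4 * C * \<gamma> ^ s < \<epsilon>"
      by (auto simp: eventually_sequentially)
    have "(\<lambda>n. real b ^ s * (1 / 2) ^ n) \<longlonglongrightarrow> 0"
      by (intro tendsto_mult_right_zero LIMSEQ_power_zero) auto
    then have "\<forall>\<^sub>F n in sequentially. real b ^ s * (1 / 2) ^ n < \<eta>"
      using \<eta> by (rule order_tendstoD(2))
    then obtain n where n: "real b ^ s * (1 / 2) ^ n < \<eta>" "n \<ge> s"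
      unfolding eventually_sequentially by (meson nle_le)
    \<comment> \<open>With this \<open>m\<close> the gcd bound reads
      \<open>\<delta> * 2 ^ n \<le> b ^ m\<close>, so the step is at most
      \<open>b ^ s / 2 ^ n\<close>.\<close>
    define m where "m = n + a"
    define k where "k = m - s"
    have m_eq: "m = k + s"
      using n(2) by (simp add: k_def m_def)
    define \<delta> where "\<delta> = gcd (d m) (int b ^ m)"
    have "\<delta> > 0"
      unfolding \<delta>_def using b2 by (intro gcd_pos_int[THEN iffD2]) simp
    have "real_of_int (\<delta> * 2 ^ n) \<le> of_int (int b ^ m)"
      using a[of m] unfolding \<delta>_def m_def of_int_le_iff by simp
    then have "of_int \<delta> * 2 ^ n \<le> real b ^ k * real b ^ s"
      by (simp add: m_eq power_add)
    then have "of_int \<delta> / real b ^ k \<le> real b ^ s * (1 / 2) ^ n"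
      using b2 by (simp add: field_simps)
    with n(1) have "of_int \<delta> / real b ^ k < \<eta>"
      by linarith
    moreover have "0 < of_int \<delta> / real b ^ k"
      using \<open>\<delta> > 0\<close> b2 by simp
    moreover have "\<bar>g (x + of_int l * (of_int \<delta> / real b ^ k)) - g x\<bar> \<le> \<epsilon>" for x l
      using g_almost_period[of x l k s] s unfolding \<delta>_def m_eq by linarith
    ultimately show "\<exists>h. 0 < h \<and> h < \<eta> \<and> (\<forall>x. \<forall>l::int. \<bar>g (x + of_int l * h) - g x\<bar> \<le> \<epsilon>)"
      by blast
  qed
  \<comment> \<open>A constant \<open>g\<close> makes \<open>f\<close> grow linearly along integers,
    which boundedness allows only for slope zero.\<close>
  have f_linear: "f (x + real n) = f x + real n * g 0" for x n
  proof (induction n)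
    case 0
    then show ?case by simp
  next
    case (Suc n)
    have "g (x + real n) = g 0"
      by (rule g_const)
    then show ?case
      using Suc.IH by (simp add: g_def algebra_simps)
  qed
  have "g 0 = 0"
  proof (rule ccontr)
    assume "g 0 \<noteq> 0"
    then obtain n where n: "2 * (M / (1 - \<gamma>)) < real n * \<bar>g 0\<bar>"
      using ex_less_of_nat_mult[of "\<bar>g 0\<bar>"] by auto
    have "real n * \<bar>g 0\<bar> = \<bar>f (0 + real n) - f 0\<bar>"
      unfolding f_linear by (simp add: abs_mult)
    also have "\<dots> \<le> 2 * (M / (1 - \<gamma>))"
      using f_bounded[of "0 + real n"] f_bounded[of 0] by linarith
    finally show False
      using n by simp
  qed
  then have "f (y + 1) = f y" for y
    using f_linear[of y 1] by simp
  then have f_int: "f (y + of_int l) = f y" for y l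
    by (rule periodic_add_of_int)
  \<comment> \<open>Periodicity removes the integer truncation of \<open>q\<close> from the argument
    of \<open>f\<close>.\<close>
  have "\<bar>S b \<gamma> \<phi> x q - f x\<bar> \<le> C * \<gamma> ^ m" for m
    using S_close_f[of x q m] by (simp add: f_int)
  then have "\<bar>S b \<gamma> \<phi> x q - f x\<bar> \<le> 0"
    by (intro LIMSEQ_le_const[OF tendsto_const_mult_power]) auto
  then show ?thesis
    by simp
qed

end

end

section \<open>The dichotomy\<close>

theorem theorem2p2:
  fixes b :: nat and \<gamma> :: real and \<phi> :: "real \<Rightarrow> real"
  assumes "b \<ge> 2" and "0 < \<gamma>" and "\<gamma> < 1"
    and "real_analytic \<phi>"
    and "\<forall>x. \<phi> (x + 1) = \<phi> x"
  shows "(cond_Hstar b \<gamma> \<phi> \<and> \<not> cond_H b \<gamma> \<phi>) \<or> (cond_H b \<gamma> \<phi> \<and> \<not> cond_Hstar b \<gamma> \<phi>)"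
proof -
  have per: "\<And>x. \<phi> (x + 1) = \<phi> x"
    using assms(5) by blast
  obtain r A where r: "r > 0"
    and ext: "\<And>x. \<exists>H. holomorphic_ext \<phi> x r H \<and> (\<forall>z\<in>ball (of_real x) r. norm (H z) \<le> A)"
    using periodic_real_analytic_uniform_ext[OF assms(4) per] by blast
  have S_ext: "\<exists>H. holomorphic_ext (\<lambda>x. S b \<gamma> \<phi> x j) x r H" for j x
    using S_holomorphic_ext[OF _ assms(2,3) r ext] assms(1) by simp
  have "\<bar>\<phi> x\<bar> \<le> A" for x
  proof -
    obtain H where H: "holomorphic_ext \<phi> x r H" "\<forall>z\<in>ball (of_real x) r. norm (H z) \<le> A"
      using ext by blast
    then have "norm (H (of_real x)) \<le> A"
      using r by simp
    moreover have "H (of_real x) = of_real (\<phi> x)"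
      using H(1) r by (simp add: holomorphic_ext_def)
    ultimately show ?thesis
      by simp
  qed
  then interpret bounded_periodic b \<gamma> \<phi> A
    using assms(1-3) per by unfold_locales
  have "cond_Hstar b \<gamma> \<phi>" if "\<not> cond_H b \<gamma> \<phi>"
  proof -
    obtain i j where ij: "i \<in> SymSpace b" "j \<in> SymSpace b" "i \<noteq> j"
      and eq: "\<And>x. x \<in> {0..1} \<Longrightarrow> S b \<gamma> \<phi> x j - S b \<gamma> \<phi> x i = 0"
      using \<open>\<not> cond_H b \<gamma> \<phi>\<close> unfolding cond_H_def by blast
    have diff_ext: "\<exists>r>0. \<exists>H. holomorphic_ext (\<lambda>x. S b \<gamma> \<phi> x j - S b \<gamma> \<phi> x i) x r H" for x
    proof -
      obtain G H where "holomorphic_ext (\<lambda>x. S b \<gamma> \<phi> x j) x r G" "holomorphic_ext (\<lambda>x. S b \<gamma> \<phi> x i) x r H"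
        using S_ext by blast
      then have "holomorphic_ext (\<lambda>x. S b \<gamma> \<phi> x j - S b \<gamma> \<phi> x i) x r (\<lambda>z. G z - H z)"
        by (auto simp: holomorphic_ext_def intro!: holomorphic_intros)
      then show ?thesis
        using r by blast
    qed
    \<comment> \<open>Equality is known only on the unit interval; the identity theorem extends it
      to the line, where the shifts of the almost-period argument take place.\<close>
    have S_eq: "S b \<gamma> \<phi> x i = S b \<gamma> \<phi> x j" for x
      using holomorphic_ext_eq_0[OF diff_ext, of 0 1 x] eq by simp
    obtain n where n: "\<not> int b ^ n dvd trunc_digits b j n - trunc_digits b i n"
      using trunc_digits_neq[OF ij] .
    have "isCont f x" for x
    proof -
      obtain H where "holomorphic_ext (\<lambda>x. S b \<gamma> \<phi> x (\<lambda>_. 0)) x r H"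
        using S_ext by blast
      then show ?thesis
        unfolding f_def using r by (rule holomorphic_ext_isCont)
    qed
    then have "S b \<gamma> \<phi> x q = f x" for x q
      using S_eq_f[OF S_eq, of n x q] n d_def[OF S_eq] by simp
    then show ?thesis
      by (simp add: cond_Hstar_def)
  qed
  moreover have "\<not> (cond_H b \<gamma> \<phi> \<and> cond_Hstar b \<gamma> \<phi>)"
  proof -
    \<comment> \<open>As \<open>b \<ge> 2\<close>, two distinct digit sequences exist, on which the
      two conditions contradict each other.\<close>
    have "(\<lambda>_. 0) \<in> SymSpace b" "(\<lambda>_. 1) \<in> SymSpace b" "(\<lambda>_::nat. 0::nat) \<noteq> (\<lambda>_. 1)"
      using assms(1) by (auto simp: SymSpace_def fun_eq_iff)
    then show ?thesis
      unfolding cond_H_def cond_Hstar_def by blast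
  qed
  ultimately show ?thesis
    by blast
qed

end
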